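(* Let $R$ be a commutative ring with unit and let $I$ be a cyclic (that is, principal) ideal of $R$ such that $R/I=S_1\oplus\cdots\oplus S_n$ for non-projective simple modules $S_1,\ldots,S_n$. Then $\operatorname{End}_R(I)/J(\operatorname{End}_R(I))\cong R/J(R)$ as rings.
   Context: $J(-)$ denotes the Jacobson radical of a ring. *)

theory Defs
  imports "HOL-Algebra.Module" "HOL-Algebra.QuotRing"
begin

section \<open>Modules\<close>

text \<open>
  The library's module records inherit the ring fields \<open>mult\<close> and \<open>one\<close>. The locale
  \<open>module\<close> does not constrain them and no definition below reads them on a module,
  so they are left \<open>undefined\<close> in the constructions.
\<close>

definition ring_as_module :: "('a, 'r) ring_scheme \<Rightarrow> ('a, 'a) module" where
  "ring_as_module R =
    \<lparr>carrier = carrier R, mult = undefined, one = undefined, zero = \<zero>\<^bsub>R\<^esub>, add = (\<oplus>\<^bsub>R\<^esub>),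
     smult = (\<otimes>\<^bsub>R\<^esub>)\<rparr>"

definition quotient_module ::
    "('a, 'r) ring_scheme \<Rightarrow> ('a, 'b, 'm) module_scheme \<Rightarrow> 'b set \<Rightarrow> ('a, 'b set) module" where
  "quotient_module R M N =
    \<lparr>carrier = a_rcosets\<^bsub>M\<^esub> N, mult = undefined, one = undefined, zero = N, add = set_add M,
     smult = (\<lambda>r X. \<Union>x\<in>X. N +>\<^bsub>M\<^esub> (r \<odot>\<^bsub>M\<^esub> x))\<rparr>"

definition direct_sum_module ::
    "('a, 'r) ring_scheme \<Rightarrow> 'i set \<Rightarrow> ('i \<Rightarrow> ('a, 'b, 'm) module_scheme) \<Rightarrow> ('a, 'i \<Rightarrow> 'b) module" where
  "direct_sum_module R A S =
    \<lparr>carrier = {x \<in> \<Pi>\<^sub>E i\<in>A. carrier (S i). finite {i \<in> A. x i \<noteq> \<zero>\<^bsub>S i\<^esub>}},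
     mult = undefined, one = undefined,
     zero = (\<lambda>i\<in>A. \<zero>\<^bsub>S i\<^esub>), add = (\<lambda>x y. \<lambda>i\<in>A. x i \<oplus>\<^bsub>S i\<^esub> y i),
     smult = (\<lambda>r x. \<lambda>i\<in>A. r \<odot>\<^bsub>S i\<^esub> x i)\<rparr>"

definition mod_hom ::
    "('a, 'r) ring_scheme \<Rightarrow> ('a, 'b, 'm) module_scheme \<Rightarrow> ('a, 'c, 'n) module_scheme \<Rightarrow> ('b \<Rightarrow> 'c) set" where
  "mod_hom R M N = {f \<in> carrier M \<rightarrow> carrier N.
     (\<forall>x\<in>carrier M. \<forall>y\<in>carrier M. f (x \<oplus>\<^bsub>M\<^esub> y) = f x \<oplus>\<^bsub>N\<^esub> f y) \<and>
     (\<forall>r\<in>carrier R. \<forall>x\<in>carrier M. f (r \<odot>\<^bsub>M\<^esub> x) = r \<odot>\<^bsub>N\<^esub> f x)}"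

definition module_isomorphic ::
    "('a, 'r) ring_scheme \<Rightarrow> ('a, 'b, 'm) module_scheme \<Rightarrow> ('a, 'c, 'n) module_scheme \<Rightarrow> bool" where
  "module_isomorphic R M N \<longleftrightarrow> (\<exists>f \<in> mod_hom R M N. bij_betw f (carrier M) (carrier N))"

definition simple_module :: "('a, 'r) ring_scheme \<Rightarrow> ('a, 'b, 'm) module_scheme \<Rightarrow> bool" where
  "simple_module R S \<longleftrightarrow> module R S \<and> carrier S \<noteq> {\<zero>\<^bsub>S\<^esub>} \<and>
     (\<forall>H. submodule H R S \<longrightarrow> H = {\<zero>\<^bsub>S\<^esub>} \<or> H = carrier S)"

text \<open>
  A definition cannot quantify over types, so the lifting property is required only for
  test modules over two fixed types. The type \<open>'b \<Rightarrow> 'a\<close> contains the free module on the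
  set \<open>carrier P\<close>, so this suffices for the lifting property against epimorphisms between
  modules over arbitrary types: see \<open>projective_module_lift\<close> below.
\<close>

definition projective_module :: "('a, 'r) ring_scheme \<Rightarrow> ('a, 'b) module \<Rightarrow> bool" where
  "projective_module R P \<longleftrightarrow> module R P \<and>
     (\<forall>(M :: ('a, 'b \<Rightarrow> 'a) module) (N :: ('a, 'b) module) g f.
        module R M \<and> module R N \<and> g \<in> mod_hom R M N \<and> g ` carrier M = carrier N \<and>
        f \<in> mod_hom R P N
        \<longrightarrow> (\<exists>h \<in> mod_hom R P M. \<forall>x\<in>carrier P. g (h x) = f x))"

text \<open>
  Endomorphisms are extensional (\<open>undefined\<close> outside the carrier), so that
  equality of ring elements is equality of maps on the module.
\<close>

definition End_ring :: "('a, 'r) ring_scheme \<Rightarrow> ('a, 'b, 'm) module_scheme \<Rightarrow> ('b \<Rightarrow> 'b) ring" where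
  "End_ring R M =
    \<lparr>carrier = mod_hom R M M \<inter> extensional (carrier M),
     mult = compose (carrier M), one = (\<lambda>x\<in>carrier M. x),
     zero = (\<lambda>x\<in>carrier M. \<zero>\<^bsub>M\<^esub>), add = (\<lambda>f g. \<lambda>x\<in>carrier M. f x \<oplus>\<^bsub>M\<^esub> g x)\<rparr>"


section \<open>The Jacobson radical\<close>

definition left_ideal :: "'a set \<Rightarrow> ('a, 'r) ring_scheme \<Rightarrow> bool" where
  "left_ideal L R \<longleftrightarrow> additive_subgroup L R \<and> (\<forall>r\<in>carrier R. \<forall>x\<in>L. r \<otimes>\<^bsub>R\<^esub> x \<in> L)"

definition maximal_left_ideal :: "'a set \<Rightarrow> ('a, 'r) ring_scheme \<Rightarrow> bool" where
  "maximal_left_ideal L R \<longleftrightarrow> left_ideal L R \<and> L \<noteq> carrier R \<and>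
     (\<forall>K. left_ideal K R \<and> L \<subseteq> K \<longrightarrow> K = L \<or> K = carrier R)"

text \<open>The intersection with the carrier only matters for the zero ring, which has no
  maximal left ideals.\<close>

definition jacobson_radical :: "('a, 'r) ring_scheme \<Rightarrow> 'a set" where
  "jacobson_radical R = carrier R \<inter> \<Inter>{L. maximal_left_ideal L R}"

lemma (in cring) left_ideal_iff_ideal: "left_ideal L R \<longleftrightarrow> ideal L R"
proof
  assume L: "left_ideal L R"
  then have sub: "additive_subgroup L R" and l: "\<And>r x. r \<in> carrier R \<Longrightarrow> x \<in> L \<Longrightarrow> r \<otimes> x \<in> L"
    by (auto simp: left_ideal_def)
  then have "x \<otimes> r \<in> L" if "r \<in> carrier R" "x \<in> L" for r x
    using that by (metis additive_subgroup.a_Hcarr m_comm)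
  with sub l show "ideal L R"
    by (simp add: ideal_def ideal_axioms_def ring_axioms)
next
  assume "ideal L R"
  then interpret ideal L R .
  show "left_ideal L R"
    by (simp add: left_ideal_def is_additive_subgroup I_l_closed)
qed

lemma (in cring) maximal_left_ideal_iff: "maximal_left_ideal L R \<longleftrightarrow> maximalideal L R"
  unfolding maximal_left_ideal_def left_ideal_iff_ideal maximalideal_def maximalideal_axioms_def
  by (auto dest: additive_subgroup.a_subset ideal.axioms(1))


section \<open>Well-formedness of the constructions\<close>

lemma (in cring) ring_as_module_is_module: "module R (ring_as_module R)"
proof (rule moduleI)
  show "abelian_group (ring_as_module R)"
  proof (rule abelian_groupI)
    show "\<exists>y\<in>carrier (ring_as_module R). y \<oplus>\<^bsub>ring_as_module R\<^esub> x = \<zero>\<^bsub>ring_as_module R\<^esub>"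
      if "x \<in> carrier (ring_as_module R)" for x
      using that by (intro bexI[of _ "\<ominus> x"]) (auto simp: ring_as_module_def l_neg)
  qed (auto simp: ring_as_module_def a_ac)
qed (auto simp: ring_as_module_def l_distr r_distr m_assoc is_cring)

lemma (in cring) submodule_ring_as_module_iff:
  "submodule J R (ring_as_module R) \<longleftrightarrow> ideal J R"
  unfolding left_ideal_iff_ideal[symmetric] left_ideal_def submodule_def submodule_axioms_def
    additive_subgroup_def
  by (auto simp: ring_as_module_def subgroup_def m_inv_def)

lemma (in module) add_rcoset: "N +>\<^bsub>M\<^esub> x = {h \<oplus>\<^bsub>M\<^esub> x | h. h \<in> N}"
  by (auto simp: a_r_coset_def r_coset_def)

lemma (in module) quotient_smult:
  assumes N: "submodule N R M" and r: "r \<in> carrier R" and x: "x \<in> carrier M"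
  shows "r \<odot>\<^bsub>quotient_module R M N\<^esub> (N +>\<^bsub>M\<^esub> x) = N +>\<^bsub>M\<^esub> (r \<odot>\<^bsub>M\<^esub> x)"
proof -
  interpret N: abelian_subgroup N M
    using N by (intro abelian_subgroupI3 additive_subgroupI)
      (auto simp: submodule_def M.abelian_group_axioms)
  have "N +>\<^bsub>M\<^esub> (r \<odot>\<^bsub>M\<^esub> y) = N +>\<^bsub>M\<^esub> (r \<odot>\<^bsub>M\<^esub> x)" if "y \<in> N +>\<^bsub>M\<^esub> x" for y
  proof -
    from that obtain h where h: "h \<in> N" "y = h \<oplus>\<^bsub>M\<^esub> x" unfolding add_rcoset by blast
    then have hc: "h \<in> carrier M" using N.a_Hcarr by blast
    have "r \<odot>\<^bsub>M\<^esub> h \<in> N" using submodule.smult_closed[OF N r h(1)] .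
    moreover have "r \<odot>\<^bsub>M\<^esub> y = r \<odot>\<^bsub>M\<^esub> h \<oplus>\<^bsub>M\<^esub> r \<odot>\<^bsub>M\<^esub> x"
      using h hc r x by (simp add: smult_r_distr)
    ultimately have "r \<odot>\<^bsub>M\<^esub> y \<in> N +>\<^bsub>M\<^esub> (r \<odot>\<^bsub>M\<^esub> x)" unfolding add_rcoset by blast
    then show ?thesis
      using r x by (intro N.a_repr_independence'[symmetric]) simp_all
  qed
  then have "(\<Union>y\<in>N +>\<^bsub>M\<^esub> x. N +>\<^bsub>M\<^esub> (r \<odot>\<^bsub>M\<^esub> y)) = N +>\<^bsub>M\<^esub> (r \<odot>\<^bsub>M\<^esub> x)"
    by (intro UN_constant_eq[OF N.a_rcos_self[OF x]] ballI)
  then show ?thesis unfolding quotient_module_def by simp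
qed

lemma (in module) quotient_module_is_module:
  assumes N: "submodule N R M"
  shows "module R (quotient_module R M N)"
proof -
  interpret N: abelian_subgroup N M
    using N by (intro abelian_subgroupI3 additive_subgroupI)
      (auto simp: submodule_def M.abelian_group_axioms)
  let ?Q = "quotient_module R M N"
  have car: "X \<in> carrier ?Q \<longleftrightarrow> (\<exists>x\<in>carrier M. X = N +>\<^bsub>M\<^esub> x)" for X
    by (auto simp: quotient_module_def A_RCOSETS_def' a_r_coset_def)
  have add: "(N +>\<^bsub>M\<^esub> x) \<oplus>\<^bsub>?Q\<^esub> (N +>\<^bsub>M\<^esub> y) = N +>\<^bsub>M\<^esub> (x \<oplus>\<^bsub>M\<^esub> y)"
    if "x \<in> carrier M" "y \<in> carrier M" for x y
    using that by (simp add: quotient_module_def N.a_rcos_sum)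
  have zero: "\<zero>\<^bsub>?Q\<^esub> = N +>\<^bsub>M\<^esub> \<zero>\<^bsub>M\<^esub>"
    using N.a_subset by (simp add: quotient_module_def)
  note sm = quotient_smult[OF N]
  have cosI: "N +>\<^bsub>M\<^esub> x \<in> carrier ?Q" if "x \<in> carrier M" for x
    using that car by blast
  have cosE: thesis if "X \<in> carrier ?Q" "\<And>x. x \<in> carrier M \<Longrightarrow> X = N +>\<^bsub>M\<^esub> x \<Longrightarrow> thesis" for X thesis
    using that car by blast
  show ?thesis
  proof (rule moduleI)
    show "abelian_group ?Q"
    proof (rule abelian_groupI)
      show "\<exists>Y\<in>carrier ?Q. Y \<oplus>\<^bsub>?Q\<^esub> X = \<zero>\<^bsub>?Q\<^esub>" if "X \<in> carrier ?Q" for X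
      proof -
        from that obtain x where x: "x \<in> carrier M" "X = N +>\<^bsub>M\<^esub> x" by (rule cosE)
        then have "(N +>\<^bsub>M\<^esub> (\<ominus>\<^bsub>M\<^esub> x)) \<oplus>\<^bsub>?Q\<^esub> X = \<zero>\<^bsub>?Q\<^esub>"
          by (simp only: add zero M.l_neg M.a_inv_closed)
        then show ?thesis using cosI[OF M.a_inv_closed[OF x(1)]] by blast
      qed
      show "X \<oplus>\<^bsub>?Q\<^esub> Y = Y \<oplus>\<^bsub>?Q\<^esub> X" if "X \<in> carrier ?Q" "Y \<in> carrier ?Q" for X Y
        using that by (elim cosE) (simp add: add M.a_comm)
      show "\<zero>\<^bsub>?Q\<^esub> \<in> carrier ?Q"
        unfolding zero by (rule cosI) simp
      show "\<zero>\<^bsub>?Q\<^esub> \<oplus>\<^bsub>?Q\<^esub> X = X" if "X \<in> carrier ?Q" for X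
        using that unfolding zero by (elim cosE) (simp only: add M.l_zero M.zero_closed)
    qed (elim cosE, simp add: add cosI M.a_assoc)+
  qed (elim cosE, simp add: sm add cosI smult_l_distr smult_r_distr smult_assoc1 | rule R.is_cring)+
qed

lemma (in cring) direct_sum_module_is_module:
  assumes S: "\<And>i. i \<in> A \<Longrightarrow> module R (S i)"
  shows "module R (direct_sum_module R A S)"
proof -
  have ag: "\<And>i. i \<in> A \<Longrightarrow> abelian_group (S i)"
    using S by (simp add: module_def)
  have am: "\<And>i. i \<in> A \<Longrightarrow> abelian_monoid (S i)"
    using ag by (simp add: abelian_group_def)
  have fin2: "finite {i \<in> A. x i \<oplus>\<^bsub>S i\<^esub> y i \<noteq> \<zero>\<^bsub>S i\<^esub>}"
    if "finite {i \<in> A. x i \<noteq> \<zero>\<^bsub>S i\<^esub>}" "finite {i \<in> A. y i \<noteq> \<zero>\<^bsub>S i\<^esub>}" for x y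
  proof (rule finite_subset[OF _ finite_UnI[OF that]])
    show "{i \<in> A. x i \<oplus>\<^bsub>S i\<^esub> y i \<noteq> \<zero>\<^bsub>S i\<^esub>} \<subseteq> {i \<in> A. x i \<noteq> \<zero>\<^bsub>S i\<^esub>} \<union> {i \<in> A. y i \<noteq> \<zero>\<^bsub>S i\<^esub>}"
      using ag by (auto simp: abelian_group_def abelian_monoid.l_zero abelian_monoid.zero_closed)
  qed
  have fin1: "finite {i \<in> A. r \<odot>\<^bsub>S i\<^esub> x i \<noteq> \<zero>\<^bsub>S i\<^esub>}"
    if "finite {i \<in> A. x i \<noteq> \<zero>\<^bsub>S i\<^esub>}" "r \<in> carrier R" for r x
    by (rule finite_subset[OF _ that(1)]) (use that in \<open>auto simp: module.smult_r_null[OF S]\<close>)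
  have inv0: "\<ominus>\<^bsub>S i\<^esub> \<zero>\<^bsub>S i\<^esub> = \<zero>\<^bsub>S i\<^esub>" if "i \<in> A" for i
    using ag[OF that] am[OF that]
    by (metis abelian_group.r_neg abelian_group.a_inv_closed abelian_monoid.l_zero
        abelian_monoid.zero_closed)
  have finm: "finite {i \<in> A. \<ominus>\<^bsub>S i\<^esub> x i \<noteq> \<zero>\<^bsub>S i\<^esub>}"
    if "finite {i \<in> A. x i \<noteq> \<zero>\<^bsub>S i\<^esub>}" for x
    by (rule finite_subset[OF _ that]) (auto simp: inv0)
  note closed = abelian_monoid.a_closed[OF am] abelian_monoid.zero_closed[OF am]
    abelian_group.a_inv_closed[OF ag] module.smult_closed[OF S]
  let ?D = "direct_sum_module R A S"
  have car: "x \<in> carrier ?D \<longleftrightarrow>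
      x \<in> extensional A \<and> (\<forall>i\<in>A. x i \<in> carrier (S i)) \<and> finite {i \<in> A. x i \<noteq> \<zero>\<^bsub>S i\<^esub>}" for x
    by (auto simp: direct_sum_module_def PiE_iff)
  have ops: "x \<oplus>\<^bsub>?D\<^esub> y = (\<lambda>i\<in>A. x i \<oplus>\<^bsub>S i\<^esub> y i)" "r \<odot>\<^bsub>?D\<^esub> x = (\<lambda>i\<in>A. r \<odot>\<^bsub>S i\<^esub> x i)"
    "\<zero>\<^bsub>?D\<^esub> = (\<lambda>i\<in>A. \<zero>\<^bsub>S i\<^esub>)" for x y r
    by (simp_all add: direct_sum_module_def)
  have eq: "x = y" if "x \<in> extensional A" "y \<in> extensional A" "\<And>i. i \<in> A \<Longrightarrow> x i = y i" for x y
    using that by (rule extensionalityI)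
  have add_cl: "x \<oplus>\<^bsub>?D\<^esub> y \<in> carrier ?D" if "x \<in> carrier ?D" "y \<in> carrier ?D" for x y
    using that fin2[of x y] by (simp add: car ops closed cong: conj_cong)
  have smult_cl: "r \<odot>\<^bsub>?D\<^esub> x \<in> carrier ?D" if "r \<in> carrier R" "x \<in> carrier ?D" for r x
    using that fin1[of x r] by (simp add: car ops closed cong: conj_cong)
  have zero_cl: "\<zero>\<^bsub>?D\<^esub> \<in> carrier ?D"
    by (simp add: car ops closed cong: conj_cong)
  show ?thesis
  proof (rule moduleI)
    show "abelian_group ?D"
    proof (rule abelian_groupI)
      show "\<exists>y\<in>carrier ?D. y \<oplus>\<^bsub>?D\<^esub> x = \<zero>\<^bsub>?D\<^esub>" if x: "x \<in> carrier ?D" for x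
      proof
        show "(\<lambda>i\<in>A. \<ominus>\<^bsub>S i\<^esub> x i) \<in> carrier ?D"
          using x finm[of x] by (simp add: car closed cong: conj_cong)
        show "(\<lambda>i\<in>A. \<ominus>\<^bsub>S i\<^esub> x i) \<oplus>\<^bsub>?D\<^esub> x = \<zero>\<^bsub>?D\<^esub>"
          using x by (intro eq) (simp_all add: car ops abelian_group.l_neg[OF ag])
      qed
      show "x \<oplus>\<^bsub>?D\<^esub> y = y \<oplus>\<^bsub>?D\<^esub> x" if "x \<in> carrier ?D" "y \<in> carrier ?D" for x y
        using that by (intro eq) (simp_all add: car ops abelian_monoid.a_comm[OF am])
    qed (rule add_cl zero_cl eq | assumption
        | simp add: car ops closed abelian_monoid.a_assoc[OF am] abelian_monoid.l_zero[OF am])+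
  qed (rule is_cring smult_cl eq | assumption
      | simp add: car ops closed module.smult_l_distr[OF S] module.smult_r_distr[OF S]
          module.smult_assoc1[OF S] module.smult_one[OF S])+
qed

lemma (in module) End_ring_is_ring: "ring (End_ring R M)"
proof -
  let ?E = "End_ring R M"
  have car: "f \<in> carrier ?E \<longleftrightarrow> f \<in> extensional (carrier M) \<and> (\<forall>x\<in>carrier M. f x \<in> carrier M) \<and>
     (\<forall>x\<in>carrier M. \<forall>y\<in>carrier M. f (x \<oplus>\<^bsub>M\<^esub> y) = f x \<oplus>\<^bsub>M\<^esub> f y) \<and>
     (\<forall>r\<in>carrier R. \<forall>x\<in>carrier M. f (r \<odot>\<^bsub>M\<^esub> x) = r \<odot>\<^bsub>M\<^esub> f x)" for f
    by (auto simp: End_ring_def mod_hom_def)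
  have ops: "f \<oplus>\<^bsub>?E\<^esub> g = (\<lambda>x\<in>carrier M. f x \<oplus>\<^bsub>M\<^esub> g x)" "f \<otimes>\<^bsub>?E\<^esub> g = (\<lambda>x\<in>carrier M. f (g x))"
    "\<zero>\<^bsub>?E\<^esub> = (\<lambda>x\<in>carrier M. \<zero>\<^bsub>M\<^esub>)" "\<one>\<^bsub>?E\<^esub> = (\<lambda>x\<in>carrier M. x)" for f g
    by (simp_all add: End_ring_def compose_def)
  have eq: "f = g" if "f \<in> extensional (carrier M)" "g \<in> extensional (carrier M)"
    "\<And>x. x \<in> carrier M \<Longrightarrow> f x = g x" for f g
    using that by (rule extensionalityI)
  have closed: "f \<oplus>\<^bsub>?E\<^esub> g \<in> carrier ?E" "f \<otimes>\<^bsub>?E\<^esub> g \<in> carrier ?E"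
    if "f \<in> carrier ?E" "g \<in> carrier ?E" for f g
    using that by (simp_all add: car ops smult_r_distr M.a_ac)
  have closed0: "\<zero>\<^bsub>?E\<^esub> \<in> carrier ?E" "\<one>\<^bsub>?E\<^esub> \<in> carrier ?E"
    by (simp_all add: car ops)
  show ?thesis
  proof (rule ringI)
    show "abelian_group ?E"
    proof (rule abelian_groupI)
      show "\<exists>g\<in>carrier ?E. g \<oplus>\<^bsub>?E\<^esub> f = \<zero>\<^bsub>?E\<^esub>" if f: "f \<in> carrier ?E" for f
      proof
        show "(\<lambda>x\<in>carrier M. \<ominus>\<^bsub>M\<^esub> f x) \<in> carrier ?E"
          using f by (simp add: car M.minus_add smult_r_minus)
        show "(\<lambda>x\<in>carrier M. \<ominus>\<^bsub>M\<^esub> f x) \<oplus>\<^bsub>?E\<^esub> f = \<zero>\<^bsub>?E\<^esub>"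
          using f by (intro eq) (simp_all add: car ops M.l_neg)
      qed
    qed (rule closed closed0 eq | assumption | simp add: car ops M.a_ac)+
    show "Group.monoid ?E"
      by (rule monoidI) (rule closed closed0 eq | assumption | simp add: car ops)+
  qed (rule eq; simp add: car ops)+
qed


section \<open>Projectivity does not depend on the types of the test modules\<close>

lemma mod_homD:
  assumes "f \<in> mod_hom R M N"
  shows "x \<in> carrier M \<Longrightarrow> f x \<in> carrier N"
    and "x \<in> carrier M \<Longrightarrow> y \<in> carrier M \<Longrightarrow> f (x \<oplus>\<^bsub>M\<^esub> y) = f x \<oplus>\<^bsub>N\<^esub> f y"
    and "r \<in> carrier R \<Longrightarrow> x \<in> carrier M \<Longrightarrow> f (r \<odot>\<^bsub>M\<^esub> x) = r \<odot>\<^bsub>N\<^esub> f x"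
  using assms by (auto simp: mod_hom_def)

lemma mod_hom_zero:
  assumes "module R M" "module R N" "f \<in> mod_hom R M N"
  shows "f \<zero>\<^bsub>M\<^esub> = \<zero>\<^bsub>N\<^esub>"
proof -
  interpret M: module R M by fact
  interpret N: module R N by fact
  have "f (\<zero>\<^bsub>R\<^esub> \<odot>\<^bsub>M\<^esub> \<zero>\<^bsub>M\<^esub>) = \<zero>\<^bsub>R\<^esub> \<odot>\<^bsub>N\<^esub> f \<zero>\<^bsub>M\<^esub>"
    by (rule mod_homD(3)[OF assms(3)]) simp_all
  then show ?thesis
    using mod_homD(1)[OF assms(3)] by simp
qed

lemma mod_hom_finsum:
  assumes "module R M" "module R N" "f \<in> mod_hom R M N" "finite A" "\<And>i. i \<in> A \<Longrightarrow> u i \<in> carrier M"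
  shows "f (\<Oplus>\<^bsub>M\<^esub>i\<in>A. u i) = (\<Oplus>\<^bsub>N\<^esub>i\<in>A. f (u i))"
proof -
  interpret M: module R M by fact
  interpret N: module R N by fact
  show ?thesis
    using assms(4,5)
  proof (induction A rule: finite_induct)
    case empty
    then show ?case by (simp add: mod_hom_zero[OF assms(1-3)])
  next
    case (insert a A)
    then have "(\<Oplus>\<^bsub>M\<^esub>i\<in>A. u i) \<in> carrier M" by (intro M.M.finsum_closed) auto
    with insert show ?case
      by (simp add: Pi_iff mod_homD[OF assms(3)])
  qed
qed

abbreviation free_module :: "('a, 'r) ring_scheme \<Rightarrow> 'b set \<Rightarrow> ('a, 'b \<Rightarrow> 'a) module" where
  "free_module R B \<equiv> direct_sum_module R B (\<lambda>_. ring_as_module R)"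

definition lincomb :: "('a, 'r) ring_scheme \<Rightarrow> ('a, 'c, 'm) module_scheme \<Rightarrow> 'b set \<Rightarrow> ('b \<Rightarrow> 'c) \<Rightarrow> ('b \<Rightarrow> 'a) \<Rightarrow> 'c" where
  "lincomb R M B c \<phi> = (\<Oplus>\<^bsub>M\<^esub>b\<in>{b \<in> B. \<phi> b \<noteq> \<zero>\<^bsub>R\<^esub>}. \<phi> b \<odot>\<^bsub>M\<^esub> c b)"

lemma free_module_carrier:
  "\<phi> \<in> carrier (free_module R B) \<longleftrightarrow>
     \<phi> \<in> extensional B \<and> (\<forall>b\<in>B. \<phi> b \<in> carrier R) \<and> finite {b \<in> B. \<phi> b \<noteq> \<zero>\<^bsub>R\<^esub>}"
  by (auto simp: direct_sum_module_def ring_as_module_def PiE_iff)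

lemma (in module) lincomb_superset:
  assumes "\<phi> \<in> carrier (free_module R B)" "\<And>b. b \<in> B \<Longrightarrow> c b \<in> carrier M"
    and "finite T" "T \<subseteq> B" "{b \<in> B. \<phi> b \<noteq> \<zero>} \<subseteq> T"
  shows "lincomb R M B c \<phi> = (\<Oplus>\<^bsub>M\<^esub>b\<in>T. \<phi> b \<odot>\<^bsub>M\<^esub> c b)"
  unfolding lincomb_def
  by (rule M.add.finprod_mono_neutral_cong_left)
    (use assms in \<open>auto simp: free_module_carrier subset_iff\<close>)

lemma (in module) lincomb_mod_hom:
  assumes c: "\<And>b. b \<in> B \<Longrightarrow> c b \<in> carrier M"
  shows "lincomb R M B c \<in> mod_hom R (free_module R B) M"
proof -
  let ?F = "free_module R B"
  interpret F: module R ?F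
    by (intro R.direct_sum_module_is_module R.ring_as_module_is_module)
  let ?supp = "\<lambda>\<phi>. {b \<in> B. \<phi> b \<noteq> \<zero>}"
  have in_M: "\<phi> b \<odot>\<^bsub>M\<^esub> c b \<in> carrier M" if "\<phi> \<in> carrier ?F" "b \<in> B" for \<phi> b
    using that c by (auto simp: free_module_carrier)
  show ?thesis
    unfolding mod_hom_def
  proof (intro CollectI conjI ballI funcsetI)
    show "lincomb R M B c \<phi> \<in> carrier M" if "\<phi> \<in> carrier ?F" for \<phi>
      unfolding lincomb_def using in_M[OF that] by (intro M.finsum_closed) auto
  next
    fix \<phi> \<psi> assume h: "\<phi> \<in> carrier ?F" "\<psi> \<in> carrier ?F"
    let ?T = "?supp \<phi> \<union> ?supp \<psi>"
    have T: "finite ?T" "?T \<subseteq> B"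
      using h by (auto simp: free_module_carrier)
    have add: "(\<phi> \<oplus>\<^bsub>?F\<^esub> \<psi>) b = \<phi> b \<oplus> \<psi> b" if "b \<in> B" for b
      using that by (simp add: direct_sum_module_def ring_as_module_def)
    have car: "\<phi> b \<in> carrier R" "\<psi> b \<in> carrier R" if "b \<in> B" for b
      using that h by (auto simp: free_module_carrier)
    have "?supp (\<phi> \<oplus>\<^bsub>?F\<^esub> \<psi>) \<subseteq> ?T"
      by (auto simp: add)
    then have "lincomb R M B c (\<phi> \<oplus>\<^bsub>?F\<^esub> \<psi>) = (\<Oplus>\<^bsub>M\<^esub>b\<in>?T. (\<phi> \<oplus>\<^bsub>?F\<^esub> \<psi>) b \<odot>\<^bsub>M\<^esub> c b)"
      using h c T by (intro lincomb_superset) auto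
    also have "\<dots> = (\<Oplus>\<^bsub>M\<^esub>b\<in>?T. \<phi> b \<odot>\<^bsub>M\<^esub> c b \<oplus>\<^bsub>M\<^esub> \<psi> b \<odot>\<^bsub>M\<^esub> c b)"
      using h c in_M car by (intro M.finsum_cong') (auto simp: add smult_l_distr)
    also have "\<dots> = (\<Oplus>\<^bsub>M\<^esub>b\<in>?T. \<phi> b \<odot>\<^bsub>M\<^esub> c b) \<oplus>\<^bsub>M\<^esub> (\<Oplus>\<^bsub>M\<^esub>b\<in>?T. \<psi> b \<odot>\<^bsub>M\<^esub> c b)"
      using h in_M by (intro M.finsum_addf) auto
    also have "(\<Oplus>\<^bsub>M\<^esub>b\<in>?T. \<phi> b \<odot>\<^bsub>M\<^esub> c b) = lincomb R M B c \<phi>"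
      using h c T by (intro lincomb_superset[symmetric]) auto
    also have "(\<Oplus>\<^bsub>M\<^esub>b\<in>?T. \<psi> b \<odot>\<^bsub>M\<^esub> c b) = lincomb R M B c \<psi>"
      using h c T by (intro lincomb_superset[symmetric]) auto
    finally show "lincomb R M B c (\<phi> \<oplus>\<^bsub>?F\<^esub> \<psi>) = lincomb R M B c \<phi> \<oplus>\<^bsub>M\<^esub> lincomb R M B c \<psi>" .
  next
    fix r \<phi> assume r: "r \<in> carrier R" and h: "\<phi> \<in> carrier ?F"
    let ?T = "?supp \<phi>"
    have T: "finite ?T" using h by (simp add: free_module_carrier)
    have sm: "(r \<odot>\<^bsub>?F\<^esub> \<phi>) b = r \<otimes> \<phi> b" if "b \<in> B" for b
      using that by (simp add: direct_sum_module_def ring_as_module_def)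
    have car: "\<phi> b \<in> carrier R" if "b \<in> B" for b
      using that h by (auto simp: free_module_carrier)
    have "lincomb R M B c (r \<odot>\<^bsub>?F\<^esub> \<phi>) = (\<Oplus>\<^bsub>M\<^esub>b\<in>?T. (r \<odot>\<^bsub>?F\<^esub> \<phi>) b \<odot>\<^bsub>M\<^esub> c b)"
      using r h c T by (intro lincomb_superset) (auto simp: sm)
    also have "\<dots> = (\<Oplus>\<^bsub>M\<^esub>b\<in>?T. r \<odot>\<^bsub>M\<^esub> (\<phi> b \<odot>\<^bsub>M\<^esub> c b))"
      using r h c in_M car by (intro M.finsum_cong') (auto simp: sm smult_assoc1)
    also have "\<dots> = r \<odot>\<^bsub>M\<^esub> lincomb R M B c \<phi>"
      unfolding lincomb_def using T r h in_M by (intro finsum_smult_ldistr[symmetric]) auto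
    finally show "lincomb R M B c (r \<odot>\<^bsub>?F\<^esub> \<phi>) = r \<odot>\<^bsub>M\<^esub> lincomb R M B c \<phi>" .
  qed
qed

lemma mod_hom_lincomb:
  assumes "module R M" "module R N" "g \<in> mod_hom R M N" "\<phi> \<in> carrier (free_module R B)"
    and c: "\<And>b. b \<in> B \<Longrightarrow> c b \<in> carrier M" and d: "\<And>b. b \<in> B \<Longrightarrow> g (c b) = d b"
  shows "g (lincomb R M B c \<phi>) = lincomb R N B d \<phi>"
proof -
  interpret M: module R M by fact
  interpret N: module R N by fact
  have car: "\<phi> b \<in> carrier R" if "b \<in> B" for b
    using that assms(4) by (auto simp: free_module_carrier)
  have "g (lincomb R M B c \<phi>) = (\<Oplus>\<^bsub>N\<^esub>b\<in>{b \<in> B. \<phi> b \<noteq> \<zero>\<^bsub>R\<^esub>}. g (\<phi> b \<odot>\<^bsub>M\<^esub> c b))"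
    unfolding lincomb_def
    using assms(4) car c by (intro mod_hom_finsum[OF assms(1-3)]) (auto simp: free_module_carrier)
  also have "\<dots> = lincomb R N B d \<phi>"
    unfolding lincomb_def
  proof (rule N.M.finsum_cong')
    have dc: "d b \<in> carrier N" if "b \<in> B" for b
      using mod_homD(1)[OF assms(3) c[OF that]] d[OF that] by simp
    show "(\<lambda>b. \<phi> b \<odot>\<^bsub>N\<^esub> d b) \<in> {b \<in> B. \<phi> b \<noteq> \<zero>\<^bsub>R\<^esub>} \<rightarrow> carrier N"
      using car dc by simp
    show "g (\<phi> b \<odot>\<^bsub>M\<^esub> c b) = \<phi> b \<odot>\<^bsub>N\<^esub> d b" if "b \<in> {b \<in> B. \<phi> b \<noteq> \<zero>\<^bsub>R\<^esub>}" for b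
      using that mod_homD(3)[OF assms(3) car c] d by simp
  qed simp
  finally show ?thesis .
qed

lemma (in module) lincomb_surj:
  "lincomb R M (carrier M) (\<lambda>x. x) ` carrier (free_module R (carrier M)) = carrier M"
proof (intro equalityI image_subsetI subsetI)
  fix \<phi> assume "\<phi> \<in> carrier (free_module R (carrier M))"
  then show "lincomb R M (carrier M) (\<lambda>x. x) \<phi> \<in> carrier M"
    using mod_homD(1)[OF lincomb_mod_hom[of "carrier M" "\<lambda>x. x"]] by simp
next
  fix x assume x: "x \<in> carrier M"
  define \<delta> where "\<delta> = (\<lambda>y\<in>carrier M. if y = x then \<one> else \<zero>)"
  have \<delta>: "\<delta> \<in> carrier (free_module R (carrier M))"
    by (auto simp: free_module_carrier \<delta>_def intro: finite_subset[of _ "{x}"])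
  have "lincomb R M (carrier M) (\<lambda>x. x) \<delta> = (\<Oplus>\<^bsub>M\<^esub>b\<in>{x}. \<delta> b \<odot>\<^bsub>M\<^esub> b)"
    using x by (intro lincomb_superset[OF \<delta>]) (auto simp: \<delta>_def)
  also have "\<dots> = x"
    using x by (simp add: \<delta>_def)
  finally show "x \<in> lincomb R M (carrier M) (\<lambda>x. x) ` carrier (free_module R (carrier M))"
    using \<delta> by (metis imageI)
qed

theorem projective_module_lift:
  fixes P :: "('a, 'b) module" and M :: "('a, 'c, 'm) module_scheme" and N :: "('a, 'd, 'n) module_scheme"
  assumes P: "projective_module R P" and M: "module R M" and N: "module R N"
    and g: "g \<in> mod_hom R M N" "g ` carrier M = carrier N" and f: "f \<in> mod_hom R P N"
  shows "\<exists>h \<in> mod_hom R P M. \<forall>x\<in>carrier P. g (h x) = f x"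
proof -
  interpret P: module R P using P by (simp add: projective_module_def)
  let ?B = "carrier P" and ?F = "free_module R (carrier P)"
  let ?e = "lincomb R P ?B (\<lambda>x. x)"
  have F: "module R ?F"
    by (intro P.R.direct_sum_module_is_module P.R.ring_as_module_is_module)
  have e: "?e \<in> mod_hom R ?F P" by (rule P.lincomb_mod_hom)
  have id: "(\<lambda>x. x) \<in> mod_hom R P P" by (simp add: mod_hom_def)
  obtain s where s: "s \<in> mod_hom R P ?F" "\<And>x. x \<in> ?B \<Longrightarrow> ?e (s x) = x"
  proof -
    have "\<exists>s \<in> mod_hom R P ?F. \<forall>x\<in>?B. ?e (s x) = x"
      using P unfolding projective_module_def
      by (elim conjE allE[of _ ?F] allE[of _ P] allE[of _ ?e] allE[of _ "\<lambda>x. x"])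
        (simp add: F P.module_axioms e P.lincomb_surj id)
    then show thesis using that by blast
  qed
  have "\<exists>m\<in>carrier M. g m = f x" if "x \<in> ?B" for x
    using mod_homD(1)[OF f that] g(2) by (metis imageE)
  then obtain c where c: "\<And>x. x \<in> ?B \<Longrightarrow> c x \<in> carrier M" "\<And>x. x \<in> ?B \<Longrightarrow> g (c x) = f x"
    by metis
  let ?h = "\<lambda>x. lincomb R M ?B c (s x)"
  have k: "lincomb R M ?B c \<in> mod_hom R ?F M"
    using c(1) by (rule module.lincomb_mod_hom[OF M])
  have "?h \<in> mod_hom R P M"
    unfolding mod_hom_def[of R P M] by (simp add: Pi_iff mod_homD[OF s(1)] mod_homD[OF k])
  moreover have "g (?h x) = f x" if x: "x \<in> ?B" for x
  proof -
    have sx: "s x \<in> carrier ?F" using mod_homD(1)[OF s(1) x] .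
    have "g (?h x) = lincomb R N ?B f (s x)"
      using mod_hom_lincomb[OF M N g(1) sx, of c f] c by blast
    also have "\<dots> = f (?e (s x))"
      using mod_hom_lincomb[OF P.module_axioms N f sx, of "\<lambda>x. x" f] by simp
    finally show ?thesis using s(2)[OF x] by simp
  qed
  ultimately show ?thesis by (intro bexI[of _ ?h] ballI)
qed

end

theory Submission
  imports Defs
begin

text \<open>
  Write \<open>I = R a\<close> and \<open>K = ann(a)\<close>. Every endomorphism of \<open>R a\<close> is multiplication by a ring
  element, so \<open>End(I)\<close> is \<open>R/K\<close>, and it remains to see that \<open>K\<close> lies in \<open>J(R)\<close>. In fact
  \<open>K\<^sup>2 = 0\<close>, because \<open>K\<close> annihilates \<open>R/I\<close> and hence \<open>K \<subseteq> I\<close>: let \<open>u\<^sub>i \<in> S\<^sub>i\<close> be the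
  component of the image of \<open>1\<close>, choose \<open>e\<^sub>i \<in> R\<close> acting on \<open>R/I\<close> as the \<open>i\<close>-th projection,
  and suppose \<open>b u\<^sub>i \<noteq> 0\<close> for some \<open>b \<in> K\<close>. Then \<open>b e\<^sub>i\<close> kills \<open>ann(u\<^sub>i)\<close>, since
  \<open>e\<^sub>i ann(u\<^sub>i) \<subseteq> I\<close> and \<open>b I = 0\<close>, and some multiple \<open>e\<close> of \<open>b e\<^sub>i\<close> fixes \<open>u\<^sub>i\<close>. The map
  \<open>t u\<^sub>i \<mapsto> t e\<close> therefore splits \<open>R \<rightarrow> S\<^sub>i\<close>, so \<open>S\<^sub>i\<close> is projective, a contradiction.
\<close>

section \<open>Ideals and maximal ideals along a surjective ring homomorphism\<close>

lemma (in ring_hom_ring) ideal_image: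
  assumes "h ` carrier R = carrier S" "ideal J R"
  shows "ideal (h ` J) S"
proof (rule idealI)
  interpret J: ideal J R by fact
  show "ring S" by (rule S.ring_axioms)
  show "subgroup (h ` J) (add_monoid S)"
    by (rule img_is_add_subgroup[OF J.a_subgroup])
  fix y x assume y: "y \<in> h ` J" and x: "x \<in> carrier S"
  obtain j r where jr: "j \<in> J" "y = h j" "r \<in> carrier R" "x = h r"
    using x y assms(1) by blast
  have "x \<otimes>\<^bsub>S\<^esub> y = h (r \<otimes> j)" "y \<otimes>\<^bsub>S\<^esub> x = h (j \<otimes> r)"
    using jr by simp_all
  then show "x \<otimes>\<^bsub>S\<^esub> y \<in> h ` J" "y \<otimes>\<^bsub>S\<^esub> x \<in> h ` J"
    using jr J.I_l_closed J.I_r_closed by blast+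
qed

text \<open>Elements with equal images differ by a kernel element, which \<open>J\<close> absorbs.
  So an ideal above the kernel can be recovered from its image.\<close>

lemma (in ring_hom_ring) hom_mem_image_iff:
  assumes "ideal J R" "a_kernel R S h \<subseteq> J" "r \<in> carrier R"
  shows "h r \<in> h ` J \<longleftrightarrow> r \<in> J"
proof
  interpret J: ideal J R by fact
  assume "h r \<in> h ` J"
  then obtain j where j: "j \<in> J" "h r = h j" by blast
  then have "r \<in> a_kernel R S h +> j"
    using assms(3) by (intro homeq_imp_rcos) auto
  then show "r \<in> J"
    using j assms(2) J.a_closed by (auto simp: a_r_coset_def')
qed (rule imageI)

lemma (in ring_hom_ring) a_kernel_subset_vimage:
  assumes "ideal J S"
  shows "a_kernel R S h \<subseteq> {r \<in> carrier R. h r \<in> J}"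
  using additive_subgroup.zero_closed[OF ideal.axioms(1)[OF assms]]
  unfolding a_kernel_def' by fastforce

text \<open>An ideal \<open>J\<close> above the preimage contains the kernel, and its image lies
  above \<open>M\<close>, hence is \<open>M\<close> or everything. By
  \<open>hom_mem_image_iff\<close> this determines \<open>J\<close>.\<close>

lemma (in ring_hom_ring) maximalideal_vimage:
  assumes surj: "h ` carrier R = carrier S" and M: "maximalideal M S"
  shows "maximalideal {r \<in> carrier R. h r \<in> M} R" (is "maximalideal ?V R")
proof -
  note idM = maximalideal.axioms(1)[OF M]
  have M_carr: "M \<subseteq> carrier S"
    by (rule additive_subgroup.a_subset[OF ideal.axioms(1)[OF idM]])
  show ?thesis
  proof (rule maximalidealI)
    show "ideal ?V R" by (rule ideal_vimage[OF idM])
    show "carrier R \<noteq> ?V"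
    proof
      assume "carrier R = ?V"
      then have "h ` carrier R \<subseteq> M" by blast
      then show False
        using maximalideal.I_notcarr[OF M] M_carr surj by simp
    qed
    fix J assume J: "ideal J R" "?V \<subseteq> J" "J \<subseteq> carrier R"
    have ker: "a_kernel R S h \<subseteq> J"
      using a_kernel_subset_vimage[OF idM] J(2) by blast
    have "M \<subseteq> h ` J"
    proof
      fix y assume "y \<in> M"
      then obtain r where "r \<in> carrier R" "y = h r"
        using M_carr surj by (metis imageE subsetD)
      then show "y \<in> h ` J" using J(2) \<open>y \<in> M\<close> by blast
    qed
    then have "h ` J = M \<or> h ` J = carrier S"
      using ideal_image[OF surj J(1)] J(3) by (intro maximalideal.I_maximal[OF M]) auto
    then show "J = ?V \<or> J = carrier R"
    proof
      assume "h ` J = M"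
      then show ?thesis using J by blast
    next
      assume "h ` J = carrier S"
      then show ?thesis
        using hom_mem_image_iff[OF J(1) ker] J(3) by auto
    qed
  qed
qed

text \<open>The other half of the correspondence: an ideal above \<open>h\<close>
  M\<open>pulls back to an ideal above\<close>M\<open>, and surjectivity recovers it from its
  preimage. The kernel condition keeps\<close>h \<open>M\<close> proper.\<close>

lemma (in ring_hom_ring) maximalideal_image:
  assumes surj: "h ` carrier R = carrier S" and M: "maximalideal M R"
    and ker: "a_kernel R S h \<subseteq> M"
  shows "maximalideal (h ` M) S"
proof -
  interpret M: maximalideal M R by fact
  note mem = hom_mem_image_iff[OF M.is_ideal ker]
  show ?thesis
  proof (rule maximalidealI)
    show "ideal (h ` M) S" by (rule ideal_image[OF surj M.is_ideal])
    show "carrier S \<noteq> h ` M"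
    proof
      assume eq: "carrier S = h ` M"
      have "r \<in> M" if "r \<in> carrier R" for r
        using that mem[OF that] eq hom_closed[OF that] by simp
      then show False using M.I_notcarr M.a_subset by blast
    qed
    fix J assume J: "ideal J S" "h ` M \<subseteq> J" "J \<subseteq> carrier S"
    let ?V = "{r \<in> carrier R. h r \<in> J}"
    have im: "h ` ?V = J"
    proof (intro equalityI subsetI)
      fix y assume "y \<in> J"
      then obtain r where "r \<in> carrier R" "y = h r"
        using J(3) surj by (metis imageE subsetD)
      then show "y \<in> h ` ?V" using \<open>y \<in> J\<close> by blast
    qed blast
    have "?V = M \<or> ?V = carrier R"
      using ideal_vimage[OF J(1)] J(2) M.a_subset by (intro M.I_maximal) auto
    then show "J = h ` M \<or> J = carrier S"
      using im surj by metis
  qed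
qed

section \<open>The Jacobson radical under a surjection\<close>

text \<open>A kernel inside the radical lies in every maximal ideal of \<open>R\<close>, so images
  and preimages match all maximal ideals of \<open>R\<close> with those of \<open>S\<close>.\<close>

lemma (in ring_hom_cring) jacobson_radical_vimage:
  assumes surj: "h ` carrier R = carrier S" and ker: "a_kernel R S h \<subseteq> jacobson_radical R"
  shows "{r \<in> carrier R. h r \<in> jacobson_radical S} = jacobson_radical R"
proof (intro equalityI subsetI)
  fix r assume r: "r \<in> {r \<in> carrier R. h r \<in> jacobson_radical S}"
  have "r \<in> M" if M: "maximalideal M R" for M
  proof -
    have kM: "a_kernel R S h \<subseteq> M"
      using ker M by (auto simp: jacobson_radical_def R.maximal_left_ideal_iff)
    have "h r \<in> h ` M"
      using r ring.maximalideal_image[OF surj M kM]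
      by (auto simp: jacobson_radical_def S.maximal_left_ideal_iff)
    then show ?thesis
      using ring.hom_mem_image_iff[OF maximalideal.axioms(1)[OF M] kM] r by simp
  qed
  then show "r \<in> jacobson_radical R"
    using r by (simp add: jacobson_radical_def R.maximal_left_ideal_iff)
next
  fix r assume "r \<in> jacobson_radical R"
  then show "r \<in> {r \<in> carrier R. h r \<in> jacobson_radical S}"
    using ring.maximalideal_vimage[OF surj]
    by (auto simp: jacobson_radical_def R.maximal_left_ideal_iff S.maximal_left_ideal_iff)
qed

lemma (in cring) ideal_jacobson_radical: "ideal (jacobson_radical R) R"
proof -
  \<comment> \<open>Inserting \<open>carrier R\<close> keeps the family nonempty, as
    \<open>i_Intersect\<close> demands, even over the zero ring.\<close>
  have "jacobson_radical R = \<Inter>(insert (carrier R) {M. maximalideal M R})"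
    by (simp add: jacobson_radical_def maximal_left_ideal_iff)
  then show ?thesis
    using i_Intersect[of "insert (carrier R) {M. maximalideal M R}"]
    by (auto intro: oneideal maximalideal.axioms(1))
qed

text \<open>Maximal ideals are prime and contain zero, so they contain every \<open>b\<close> of
  square zero.\<close>

lemma (in cring) square_zero_in_jacobson_radical:
  assumes "b \<in> carrier R" "b \<otimes> b = \<zero>"
  shows "b \<in> jacobson_radical R"
proof -
  have "b \<in> M" if "maximalideal M R" for M
  proof -
    interpret M: primeideal M R
      by (rule maximalideal_prime[OF that])
    show ?thesis
      using M.I_prime[OF assms(1,1)] assms(2) M.zero_closed by simp
  qed
  then show ?thesis
    using assms(1) by (simp add: jacobson_radical_def maximal_left_ideal_iff)
qed

text \<open>First isomorphism theorem for the composite of \<open>h\<close> with the projection of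
  \<open>S\<close> modulo its radical; by \<open>jacobson_radical_vimage\<close> its kernel is the
  radical of \<open>R\<close>.\<close>

lemma (in ring_hom_cring) quot_jacobson_radical_iso:
  assumes surj: "h ` carrier R = carrier S" and ker: "a_kernel R S h \<subseteq> jacobson_radical R"
  shows "S Quot jacobson_radical S \<simeq> R Quot jacobson_radical R"
proof -
  let ?J = "jacobson_radical S"
  interpret J: ideal ?J S by (rule S.ideal_jacobson_radical)
  let ?g = "\<lambda>r. ?J +>\<^bsub>S\<^esub> h r"
  have q: "(+>\<^bsub>S\<^esub>) ?J \<in> ring_hom S (S Quot ?J)" by (rule J.rcos_ring_hom)
  have "?g \<in> ring_hom R (S Quot ?J)"
    using ring_hom_trans[OF homh q] unfolding comp_def .
  then have g: "ring_hom_ring R (S Quot ?J) ?g"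
    by (rule ring_hom_ringI2[OF R.ring_axioms J.quotient_is_ring])
  have "?g r = ?J \<longleftrightarrow> h r \<in> ?J" if "r \<in> carrier R" for r
  proof
    show "h r \<in> ?J" if "?g r = ?J"
      using J.a_rcos_self[OF hom_closed[OF \<open>r \<in> carrier R\<close>]] unfolding that .
  qed (rule J.a_rcos_const)
  moreover have "\<zero>\<^bsub>S Quot ?J\<^esub> = ?J" by (simp add: FactRing_def)
  ultimately have "a_kernel R (S Quot ?J) ?g = {r \<in> carrier R. h r \<in> ?J}"
    unfolding a_kernel_def' by blast
  also have "\<dots> = jacobson_radical R"
    by (rule jacobson_radical_vimage[OF assms])
  finally have k: "a_kernel R (S Quot ?J) ?g = jacobson_radical R" .
  have "?g ` carrier R = (+>\<^bsub>S\<^esub>) ?J ` carrier S"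
    using surj by (metis image_image)
  also have "\<dots> = carrier (S Quot ?J)"
    by (auto simp: FactRing_def A_RCOSETS_def')
  finally have "R Quot jacobson_radical R \<simeq> S Quot ?J"
    using ring_hom_ring.FactRing_iso[OF g] unfolding k by simp
  then show ?thesis
    by (rule ring_iso_sym[OF ideal.quotient_is_ring[OF R.ideal_jacobson_radical]])
qed

section \<open>Simple, cyclic and projective modules\<close>

text \<open>The multiples of \<open>v\<close> form a submodule containing \<open>v\<close>, which is
  nonzero, so simplicity leaves only the whole module.\<close>

lemma (in module) simple_module_cyclic:
  assumes S: "simple_module R M" and v: "v \<in> carrier M" "v \<noteq> \<zero>\<^bsub>M\<^esub>" and x: "x \<in> carrier M"
  shows "\<exists>t\<in>carrier R. x = t \<odot>\<^bsub>M\<^esub> v"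
proof -
  let ?H = "(\<lambda>t. t \<odot>\<^bsub>M\<^esub> v) ` carrier R"
  have "submodule ?H R M"
  proof (rule submoduleI)
    show "\<zero>\<^bsub>M\<^esub> \<in> ?H" using v by (intro image_eqI[of _ _ \<zero>]) simp_all
    show "\<ominus>\<^bsub>M\<^esub> y \<in> ?H" if "y \<in> ?H" for y
      using that v by (auto simp: smult_l_minus[symmetric])
    show "y \<oplus>\<^bsub>M\<^esub> z \<in> ?H" if "y \<in> ?H" "z \<in> ?H" for y z
      using that v by (auto simp: smult_l_distr[symmetric])
    show "r \<odot>\<^bsub>M\<^esub> y \<in> ?H" if "r \<in> carrier R" "y \<in> ?H" for r y
      using that v by (auto simp: smult_assoc1[symmetric])
  qed (use v in auto)
  moreover have "v \<in> ?H" using v by (intro image_eqI[of _ _ \<one>]) simp_all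
  ultimately have "?H = carrier M"
    using S v(2) unfolding simple_module_def by blast
  then show ?thesis using x by blast
qed

text \<open>The map sending \<open>t u\<close> to \<open>t e\<close> is well defined by
  \<open>ann\<close> and, because \<open>e\<close> fixes \<open>u\<close>, is a section of the map
  from \<open>R\<close> to \<open>P\<close> sending \<open>t\<close> to \<open>t u\<close>. Thus
  \<open>P\<close> is a direct summand of \<open>R\<close>; the proof writes the resulting lift down
  directly.\<close>

lemma projective_module_cyclicI:
  fixes P :: "('a, 'b) module"
  assumes P: "module R P" and u: "u \<in> carrier P"
    and gen: "\<And>x. x \<in> carrier P \<Longrightarrow> \<exists>t\<in>carrier R. x = t \<odot>\<^bsub>P\<^esub> u"
    and e: "e \<in> carrier R" "e \<odot>\<^bsub>P\<^esub> u = u"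
    and ann: "\<And>t. t \<in> carrier R \<Longrightarrow> t \<odot>\<^bsub>P\<^esub> u = \<zero>\<^bsub>P\<^esub> \<Longrightarrow> t \<otimes>\<^bsub>R\<^esub> e = \<zero>\<^bsub>R\<^esub>"
  shows "projective_module R P"
  unfolding projective_module_def
proof (intro conjI allI impI P)
  fix M :: "('a, 'b \<Rightarrow> 'a) module" and N :: "('a, 'b) module" and g f
  assume A: "module R M \<and> module R N \<and> g \<in> mod_hom R M N \<and> g ` carrier M = carrier N \<and>
    f \<in> mod_hom R P N"
  interpret P: module R P by fact
  interpret M: module R M using A by simp
  interpret N: module R N using A by simp
  have g: "g \<in> mod_hom R M N" and f: "f \<in> mod_hom R P N" using A by simp_all
  obtain y where y: "y \<in> carrier M" "g y = f u"
    using A mod_homD(1)[OF f u] by (metis imageE)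
  \<comment> \<open>\<open>c x\<close> is an arbitrary coefficient of \<open>x\<close> with respect
    to \<open>u\<close>. The lift sends \<open>u\<close> to \<open>e y\<close>, where
    \<open>y\<close> is a preimage of \<open>f u\<close>.\<close>
  define c where "c x = (SOME t. t \<in> carrier R \<and> x = t \<odot>\<^bsub>P\<^esub> u)" for x
  have c: "c x \<in> carrier R" "c x \<odot>\<^bsub>P\<^esub> u = x" if "x \<in> carrier P" for x
    using someI_ex[of "\<lambda>t. t \<in> carrier R \<and> x = t \<odot>\<^bsub>P\<^esub> u"] gen[OF that]
    unfolding c_def by metis+
  define h where "h x = (c x \<otimes>\<^bsub>R\<^esub> e) \<odot>\<^bsub>M\<^esub> y" for x
  \<comment> \<open>Multiplication by \<open>e\<close> removes the ambiguity of the coefficient: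
    \<open>ann\<close> is applied to \<open>s - t\<close>.\<close>
  have eq: "s \<otimes>\<^bsub>R\<^esub> e = t \<otimes>\<^bsub>R\<^esub> e"
    if st: "s \<in> carrier R" "t \<in> carrier R" "s \<odot>\<^bsub>P\<^esub> u = t \<odot>\<^bsub>P\<^esub> u" for s t
  proof -
    have "(s \<ominus>\<^bsub>R\<^esub> t) \<odot>\<^bsub>P\<^esub> u = \<zero>\<^bsub>P\<^esub>"
      using st u by (simp add: P.R.minus_eq P.smult_l_distr P.smult_l_minus P.M.r_neg)
    then have "(s \<ominus>\<^bsub>R\<^esub> t) \<otimes>\<^bsub>R\<^esub> e = \<zero>\<^bsub>R\<^esub>"
      using st ann by simp
    then have "s \<otimes>\<^bsub>R\<^esub> e \<oplus>\<^bsub>R\<^esub> \<ominus>\<^bsub>R\<^esub> (t \<otimes>\<^bsub>R\<^esub> e) = \<zero>\<^bsub>R\<^esub>"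
      using st e(1) by (simp add: P.R.minus_eq P.R.l_distr P.R.l_minus)
    then show ?thesis
      using st e(1) P.R.minus_equality[of "s \<otimes>\<^bsub>R\<^esub> e" "\<ominus>\<^bsub>R\<^esub> (t \<otimes>\<^bsub>R\<^esub> e)"] by simp
  qed
  have h: "h (t \<odot>\<^bsub>P\<^esub> u) = (t \<otimes>\<^bsub>R\<^esub> e) \<odot>\<^bsub>M\<^esub> y" if "t \<in> carrier R" for t
    unfolding h_def using that u c[of "t \<odot>\<^bsub>P\<^esub> u"] eq[of "c (t \<odot>\<^bsub>P\<^esub> u)" t] by simp
  have "h \<in> mod_hom R P M"
    unfolding mod_hom_def
  proof (intro CollectI conjI funcsetI ballI)
    show "h x \<in> carrier M" if "x \<in> carrier P" for x
      unfolding h_def using that c e(1) y(1) by simp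
  next
    fix x x' assume "x \<in> carrier P" "x' \<in> carrier P"
    then obtain s t where st: "s \<in> carrier R" "x = s \<odot>\<^bsub>P\<^esub> u" "t \<in> carrier R" "x' = t \<odot>\<^bsub>P\<^esub> u"
      using gen by metis
    then have "x \<oplus>\<^bsub>P\<^esub> x' = (s \<oplus>\<^bsub>R\<^esub> t) \<odot>\<^bsub>P\<^esub> u"
      using u by (simp add: P.smult_l_distr)
    then show "h (x \<oplus>\<^bsub>P\<^esub> x') = h x \<oplus>\<^bsub>M\<^esub> h x'"
      using st y(1) e(1) by (simp add: h P.R.l_distr M.smult_l_distr)
  next
    fix r x assume r: "r \<in> carrier R" and "x \<in> carrier P"
    then obtain t where t: "t \<in> carrier R" "x = t \<odot>\<^bsub>P\<^esub> u"
      using gen by metis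
    then have "r \<odot>\<^bsub>P\<^esub> x = (r \<otimes>\<^bsub>R\<^esub> t) \<odot>\<^bsub>P\<^esub> u"
      using u r by (simp add: P.smult_assoc1)
    then show "h (r \<odot>\<^bsub>P\<^esub> x) = r \<odot>\<^bsub>M\<^esub> h x"
      using r t y(1) e(1) by (simp add: h P.R.m_assoc M.smult_assoc1)
  qed
  moreover have "g (h x) = f x" if "x \<in> carrier P" for x
  proof -
    obtain t where t: "t \<in> carrier R" "x = t \<odot>\<^bsub>P\<^esub> u"
      using gen \<open>x \<in> carrier P\<close> by metis
    \<comment> \<open>Passing from \<open>g\<close> to \<open>f\<close> moves the scalar
      \<open>t e\<close> back onto \<open>u\<close>, where \<open>e\<close> disappears since it
      fixes \<open>u\<close>.\<close>
    have "g (h x) = (t \<otimes>\<^bsub>R\<^esub> e) \<odot>\<^bsub>N\<^esub> f u"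
      using t e(1) y by (simp add: h mod_homD(3)[OF g])
    also have "\<dots> = f ((t \<otimes>\<^bsub>R\<^esub> e) \<odot>\<^bsub>P\<^esub> u)"
      using t e(1) u by (simp add: mod_homD(3)[OF f])
    also have "(t \<otimes>\<^bsub>R\<^esub> e) \<odot>\<^bsub>P\<^esub> u = x"
      using t e u by (simp add: P.smult_assoc1)
    finally show ?thesis .
  qed
  ultimately show "\<exists>h\<in>mod_hom R P M. \<forall>x\<in>carrier P. g (h x) = f x" by blast
qed

text \<open>By simplicity some \<open>r\<close> brings \<open>b u\<close> back to \<open>u\<close>.
  Then \<open>r b e\<close> still fixes \<open>u\<close>, and the factor \<open>b\<close> makes it
  annihilate every \<open>t\<close> that kills \<open>u\<close>, as the cyclic criterion
  requires.\<close>

lemma simple_projective_module_if_not_annihilated: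
  fixes P :: "('a, 'b) module"
  assumes P: "simple_module R P" and u: "u \<in> carrier P"
    and b: "b \<in> carrier R" "b \<odot>\<^bsub>P\<^esub> u \<noteq> \<zero>\<^bsub>P\<^esub>"
    and e: "e \<in> carrier R" "e \<odot>\<^bsub>P\<^esub> u = u"
    and ann: "\<And>t. t \<in> carrier R \<Longrightarrow> t \<odot>\<^bsub>P\<^esub> u = \<zero>\<^bsub>P\<^esub> \<Longrightarrow> b \<otimes>\<^bsub>R\<^esub> (t \<otimes>\<^bsub>R\<^esub> e) = \<zero>\<^bsub>R\<^esub>"
  shows "projective_module R P"
proof -
  interpret P: module R P using P by (simp add: simple_module_def)
  have u0: "u \<noteq> \<zero>\<^bsub>P\<^esub>" using b by auto
  obtain r where r: "r \<in> carrier R" "u = r \<odot>\<^bsub>P\<^esub> (b \<odot>\<^bsub>P\<^esub> u)"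
    using P.simple_module_cyclic[OF P _ b(2) u] b(1) u by auto
  let ?e = "r \<otimes>\<^bsub>R\<^esub> b \<otimes>\<^bsub>R\<^esub> e"
  show ?thesis
  proof (rule projective_module_cyclicI[OF P.module_axioms u P.simple_module_cyclic[OF P u u0]])
    show "?e \<in> carrier R" using r b e by simp
    show "?e \<odot>\<^bsub>P\<^esub> u = u" using r b(1) e u by (simp add: P.smult_assoc1)
    fix t assume t: "t \<in> carrier R" "t \<odot>\<^bsub>P\<^esub> u = \<zero>\<^bsub>P\<^esub>"
    have "t \<otimes>\<^bsub>R\<^esub> ?e = r \<otimes>\<^bsub>R\<^esub> (b \<otimes>\<^bsub>R\<^esub> (t \<otimes>\<^bsub>R\<^esub> e))"
      using t r b e by (simp add: P.R.m_ac)
    then show "t \<otimes>\<^bsub>R\<^esub> ?e = \<zero>\<^bsub>R\<^esub>" using ann[OF t] r by simp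
  qed
qed

section \<open>The annihilator of the ideal lies in the ideal\<close>

text \<open>Through the isomorphism, an element of \<open>R\<close> lies in \<open>I\<close> as soon
  as it kills every component of the image of 1. An annihilator \<open>b\<close> of \<open>I\<close>
  missing one component would make that summand projective.\<close>

lemma (in cring) annihilator_subset:
  fixes S :: "'i \<Rightarrow> ('a, 'c) module"
  assumes I: "ideal I R" and "finite A"
    and S: "\<And>i. i \<in> A \<Longrightarrow> simple_module R (S i)"
    and np: "\<And>i. i \<in> A \<Longrightarrow> \<not> projective_module R (S i)"
    and iso: "module_isomorphic R (quotient_module R (ring_as_module R) I) (direct_sum_module R A S)"
    and b: "b \<in> carrier R" "\<And>x. x \<in> I \<Longrightarrow> b \<otimes> x = \<zero>"
  shows "b \<in> I"
proof -
  let ?M = "ring_as_module R" and ?D = "direct_sum_module R A S"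
  let ?Q = "quotient_module R ?M I"
  interpret I: ideal I R by fact
  interpret M: module R ?M by (rule ring_as_module_is_module)
  have sub: "submodule I R ?M" using I by (simp add: submodule_ring_as_module_iff)
  interpret Q: module R ?Q by (rule M.quotient_module_is_module[OF sub])
  have mS: "module R (S i)" if "i \<in> A" for i
    using S[OF that] by (simp add: simple_module_def)
  interpret D: module R ?D by (rule direct_sum_module_is_module[OF mS])
  obtain \<phi> where \<phi>: "\<phi> \<in> mod_hom R ?Q ?D" "bij_betw \<phi> (carrier ?Q) (carrier ?D)"
    using iso by (auto simp: module_isomorphic_def)
  have cos: "I +>\<^bsub>?M\<^esub> x = I +> x" for x
    by (simp add: a_r_coset_def' ring_as_module_def)
  have carQ: "carrier ?Q = (+>) I ` carrier R"
    by (auto simp: quotient_module_def A_RCOSETS_def' a_r_coset_def' ring_as_module_def)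
  have zeroQ: "\<zero>\<^bsub>?Q\<^esub> = I" by (simp add: quotient_module_def)
  have smQ: "r \<odot>\<^bsub>?Q\<^esub> (I +> x) = I +> (r \<otimes> x)" if "r \<in> carrier R" "x \<in> carrier R" for r x
    using M.quotient_smult[OF sub, of r x] that unfolding cos by (simp add: ring_as_module_def)
  have smD: "(r \<odot>\<^bsub>?D\<^esub> x) i = r \<odot>\<^bsub>S i\<^esub> x i" if "i \<in> A" for r x i
    using that by (simp add: direct_sum_module_def)
  have zeroD: "\<zero>\<^bsub>?D\<^esub> = (\<lambda>i\<in>A. \<zero>\<^bsub>S i\<^esub>)" by (simp add: direct_sum_module_def)
  \<comment> \<open>Since \<open>A\<close> is finite, the finite-support condition holds
    automatically.\<close>
  have carD: "x \<in> carrier ?D \<longleftrightarrow> x \<in> extensional A \<and> (\<forall>i\<in>A. x i \<in> carrier (S i))" for x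
    using \<open>finite A\<close> by (auto simp: direct_sum_module_def PiE_iff)
  have eqD: "x = y" if "x \<in> carrier ?D" "y \<in> carrier ?D" "\<And>i. i \<in> A \<Longrightarrow> x i = y i" for x y
    using that by (intro extensionalityI[of x A y]) (auto simp: carD)
  define u where "u = \<phi> (I +> \<one>)"
  have u: "u \<in> carrier ?D"
    unfolding u_def by (rule mod_homD(1)[OF \<phi>(1)]) (simp add: carQ)
  have uS: "u i \<in> carrier (S i)" if "i \<in> A" for i
    using u that by (simp add: carD)
  have \<phi>_cos: "\<phi> (I +> r) = r \<odot>\<^bsub>?D\<^esub> u" if "r \<in> carrier R" for r
    unfolding u_def using mod_homD(3)[OF \<phi>(1) that, of "I +> \<one>"] that by (simp add: carQ smQ)
  \<comment> \<open>If \<open>r\<close> kills all components of \<open>u\<close>, then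
    \<open>\<phi>\<close> sends the coset of \<open>r\<close> to zero, and injectivity makes this
    coset \<open>I\<close>.\<close>
  have memI: "r \<in> I" if r: "r \<in> carrier R" and 0: "\<And>i. i \<in> A \<Longrightarrow> r \<odot>\<^bsub>S i\<^esub> u i = \<zero>\<^bsub>S i\<^esub>" for r
  proof -
    have "r \<odot>\<^bsub>?D\<^esub> u = \<zero>\<^bsub>?D\<^esub>"
      by (rule eqD) (use r u 0 in \<open>simp_all add: smD, simp_all add: zeroD\<close>)
    then have "\<phi> (I +> r) = \<phi> I"
      using mod_hom_zero[OF Q.module_axioms D.module_axioms \<phi>(1)] by (simp add: \<phi>_cos r zeroQ)
    moreover have "I +> r \<in> carrier ?Q" "I \<in> carrier ?Q"
      using r Q.M.zero_closed by (simp_all add: carQ zeroQ)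
    ultimately have "I +> r = I"
      using \<phi>(2) by (meson bij_betw_imp_inj_on inj_onD)
    then show ?thesis using I.a_rcos_self[OF r] by simp
  qed
  have "b \<odot>\<^bsub>S i\<^esub> u i = \<zero>\<^bsub>S i\<^esub>" if i: "i \<in> A" for i
  proof (rule ccontr)
    assume nz: "b \<odot>\<^bsub>S i\<^esub> u i \<noteq> \<zero>\<^bsub>S i\<^esub>"
    \<comment> \<open>\<open>w\<close> keeps only the \<open>i\<close>-th component of
      \<open>u\<close>. By surjectivity it is the image of the coset of some \<open>e\<close>, which
      therefore acts on \<open>u\<close> as the \<open>i\<close>-th projection.\<close>
    define w where "w = (\<lambda>j\<in>A. if j = i then u j else \<zero>\<^bsub>S j\<^esub>)"
    have zS: "\<zero>\<^bsub>S j\<^esub> \<in> carrier (S j)" if "j \<in> A" for j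
    proof -
      interpret Sj: module R "S j" by (rule mS[OF that])
      show ?thesis by simp
    qed
    have "w \<in> carrier ?D" by (simp add: carD w_def uS zS)
    then obtain X where "X \<in> carrier ?Q" "\<phi> X = w"
      using \<phi>(2) by (metis bij_betw_imp_surj_on imageE)
    then obtain e where e: "e \<in> carrier R" "\<phi> (I +> e) = w"
      by (auto simp: carQ)
    have eu: "e \<odot>\<^bsub>S j\<^esub> u j = (if j = i then u j else \<zero>\<^bsub>S j\<^esub>)" if "j \<in> A" for j
    proof -
      have "(e \<odot>\<^bsub>?D\<^esub> u) j = w j"
        using e(2) unfolding \<phi>_cos[OF e(1)] by (rule fun_cong)
      then show ?thesis unfolding smD[OF that] by (simp only: w_def restrict_apply' that)
    qed
    have "projective_module R (S i)"
    proof (rule simple_projective_module_if_not_annihilated[OF S[OF i] uS[OF i] b(1) nz e(1)])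
      show "e \<odot>\<^bsub>S i\<^esub> u i = u i" using eu[OF i] by simp
      fix t assume t: "t \<in> carrier R" "t \<odot>\<^bsub>S i\<^esub> u i = \<zero>\<^bsub>S i\<^esub>"
      \<comment> \<open>For \<open>j = i\<close> the factor \<open>t\<close> kills what
        \<open>e\<close> leaves fixed; for other \<open>j\<close> the factor \<open>e\<close>
        already gives zero.\<close>
      have "(t \<otimes> e) \<odot>\<^bsub>S j\<^esub> u j = \<zero>\<^bsub>S j\<^esub>" if j: "j \<in> A" for j
      proof -
        interpret Sj: module R "S j" by (rule mS[OF j])
        show ?thesis using eu[OF j] t e(1) uS[OF j] by (simp add: Sj.smult_assoc1)
      qed
      then have "t \<otimes> e \<in> I" using t(1) e(1) by (intro memI) simp_all
      then show "b \<otimes> (t \<otimes> e) = \<zero>" by (rule b(2))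
    qed
    then show False using np[OF i] by contradiction
  qed
  then show ?thesis using b(1) by (intro memI)
qed

section \<open>The endomorphism ring of a principal ideal\<close>

text \<open>An endomorphism is determined by its value at the generator \<open>a\<close>. That value
  is \<open>c a\<close> for some \<open>c\<close>, so the endomorphism is multiplication by
  \<open>c\<close>; it vanishes exactly when \<open>c a\<close> does.\<close>

lemma (in cring) End_ring_PIdl:
  fixes a defines "M \<equiv> (ring_as_module R)\<lparr>carrier := PIdl a\<rparr>"
  defines "\<rho> \<equiv> \<lambda>r. \<lambda>x\<in>PIdl a. r \<otimes> x"
  assumes a: "a \<in> carrier R"
  shows "\<rho> ` carrier R = carrier (End_ring R M)"
    and "ring_hom_cring R (End_ring R M) \<rho>"
    and "a_kernel R (End_ring R M) \<rho> = {r \<in> carrier R. r \<otimes> a = \<zero>}"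
proof -
  let ?E = "End_ring R M" and ?I = "PIdl a"
  interpret I: ideal ?I R by (rule cgenideal_ideal[OF a])
  have aI: "a \<in> ?I" by (rule cgenideal_self[OF a])
  have "submodule ?I R (ring_as_module R)"
    by (simp add: submodule_ring_as_module_iff I.is_ideal)
  then interpret M: module R M
    unfolding M_def by (rule submodule.submodule_is_module[OF _ ring_as_module_is_module])
  interpret E: ring ?E by (rule M.End_ring_is_ring)
  have M: "carrier M = ?I" "\<And>x y. x \<oplus>\<^bsub>M\<^esub> y = x \<oplus> y" "\<And>r x. r \<odot>\<^bsub>M\<^esub> x = r \<otimes> x" "\<zero>\<^bsub>M\<^esub> = \<zero>"
    by (simp_all add: M_def ring_as_module_def)
  have car: "f \<in> carrier ?E \<longleftrightarrow> f \<in> extensional ?I \<and> (\<forall>x\<in>?I. f x \<in> ?I) \<and>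
     (\<forall>x\<in>?I. \<forall>y\<in>?I. f (x \<oplus> y) = f x \<oplus> f y) \<and>
     (\<forall>r\<in>carrier R. \<forall>x\<in>?I. f (r \<otimes> x) = r \<otimes> f x)" for f
    by (auto simp: End_ring_def mod_hom_def M)
  have ops: "f \<oplus>\<^bsub>?E\<^esub> g = (\<lambda>x\<in>?I. f x \<oplus> g x)" "f \<otimes>\<^bsub>?E\<^esub> g = (\<lambda>x\<in>?I. f (g x))"
    "\<zero>\<^bsub>?E\<^esub> = (\<lambda>x\<in>?I. \<zero>)" "\<one>\<^bsub>?E\<^esub> = (\<lambda>x\<in>?I. x)" for f g
    by (simp_all add: End_ring_def compose_def M)
  have \<rho>: "\<rho> r \<in> carrier ?E" if "r \<in> carrier R" for r
    using that by (auto simp: car \<rho>_def I.I_l_closed r_distr m_lcomm)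
  show surj: "\<rho> ` carrier R = carrier ?E"
  proof (intro equalityI subsetI)
    fix f assume f: "f \<in> carrier ?E"
    then have "f a \<in> ?I" using aI by (simp add: car)
    then obtain c where c: "c \<in> carrier R" "f a = c \<otimes> a"
      unfolding cgenideal_def by blast
    have "f = \<rho> c"
    proof (rule extensionalityI[of _ ?I])
      fix x assume "x \<in> ?I"
      then obtain r where r: "r \<in> carrier R" "x = r \<otimes> a"
        unfolding cgenideal_def by blast
      \<comment> \<open>With \<open>x = r a\<close>, linearity gives \<open>r (c a)\<close>, which
        equals \<open>c x\<close> by commutativity.\<close>
      then have "f x = r \<otimes> f a" using f aI by (simp add: car)
      then show "f x = \<rho> c x" using c r a \<open>x \<in> ?I\<close> by (simp add: \<rho>_def m_lcomm)
    qed (use f in \<open>auto simp: car \<rho>_def\<close>)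
    then show "f \<in> \<rho> ` carrier R" using c(1) by blast
  qed (use \<rho> in auto)
  have mult: "\<rho> r \<otimes>\<^bsub>?E\<^esub> \<rho> s = \<rho> (r \<otimes> s)" if "r \<in> carrier R" "s \<in> carrier R" for r s
    using that by (auto simp: \<rho>_def ops I.I_l_closed m_assoc intro!: restrict_ext)
  have hom: "ring_hom_ring R ?E \<rho>"
  proof (rule ring_hom_ringI[OF ring_axioms E.ring_axioms \<rho> mult[symmetric]])
    show "\<rho> (r \<oplus> s) = \<rho> r \<oplus>\<^bsub>?E\<^esub> \<rho> s" if "r \<in> carrier R" "s \<in> carrier R" for r s
      using that by (auto simp: \<rho>_def ops l_distr intro!: restrict_ext)
    show "\<rho> \<one> = \<one>\<^bsub>?E\<^esub>"
      by (auto simp: \<rho>_def ops intro!: restrict_ext)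
  qed
  \<comment> \<open>Commutativity passes from \<open>R\<close> to its image under
    \<open>\<rho>\<close>.\<close>
  have "cring ?E"
  proof (intro cring.intro comm_monoid.intro comm_monoid_axioms.intro E.ring_axioms E.monoid_axioms)
    fix f g assume "f \<in> carrier ?E" "g \<in> carrier ?E"
    then obtain r s where "r \<in> carrier R" "s \<in> carrier R" "f = \<rho> r" "g = \<rho> s"
      using surj by (metis imageE)
    then show "f \<otimes>\<^bsub>?E\<^esub> g = g \<otimes>\<^bsub>?E\<^esub> f" by (simp add: mult m_comm)
  qed
  then show "ring_hom_cring R ?E \<rho>"
    by (rule ring_hom_cringI[OF hom is_cring])
  have "\<rho> r = \<zero>\<^bsub>?E\<^esub> \<longleftrightarrow> r \<otimes> a = \<zero>" if r: "r \<in> carrier R" for r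
  proof
    assume "\<rho> r = \<zero>\<^bsub>?E\<^esub>"
    then have "\<rho> r a = (\<lambda>x\<in>?I. \<zero>) a" by (simp add: ops)
    then show "r \<otimes> a = \<zero>" using aI by (simp add: \<rho>_def)
  next
    assume 0: "r \<otimes> a = \<zero>"
    have "r \<otimes> x = \<zero>" if "x \<in> ?I" for x
    proof -
      obtain t where t: "t \<in> carrier R" "x = t \<otimes> a"
        using \<open>x \<in> ?I\<close> unfolding cgenideal_def by blast
      then have "r \<otimes> x = t \<otimes> (r \<otimes> a)" using r a by (simp add: m_lcomm)
      then show ?thesis using 0 t by simp
    qed
    then show "\<rho> r = \<zero>\<^bsub>?E\<^esub>" by (auto simp: \<rho>_def ops intro!: restrict_ext)
  qed
  then show "a_kernel R ?E \<rho> = {r \<in> carrier R. r \<otimes> a = \<zero>}"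
    by (auto simp: a_kernel_def')
qed

theorem corollary1p18:
  fixes R :: "('a, 'r) ring_scheme"
    and I :: "'a set"
    and n :: nat
    and S :: "nat \<Rightarrow> ('a, 'b) module"
  assumes "cring R"
    and "principalideal I R"
    and "\<And>i. i \<in> {1..n} \<Longrightarrow> simple_module R (S i)"
    and "\<And>i. i \<in> {1..n} \<Longrightarrow> \<not> projective_module R (S i)"
    and "module_isomorphic R (quotient_module R (ring_as_module R) I) (direct_sum_module R {1..n} S)"
  shows "End_ring R ((ring_as_module R)\<lparr>carrier := I\<rparr>)
           Quot jacobson_radical (End_ring R ((ring_as_module R)\<lparr>carrier := I\<rparr>))
         \<simeq> R Quot jacobson_radical R"
proof -
  interpret cring R by fact
  obtain a where a: "a \<in> carrier R" "I = PIdl\<^bsub>R\<^esub> a"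
    using principalideal.generate[OF assms(2)] cgenideal_eq_genideal by metis
  have memI: "x \<in> I \<longleftrightarrow> (\<exists>r\<in>carrier R. x = r \<otimes>\<^bsub>R\<^esub> a)" for x
    by (auto simp: a(2) cgenideal_def)
  \<comment> \<open>The elements killing \<open>a\<close> form the kernel of \<open>\<rho>\<close>;
    this inclusion is the kernel hypothesis of \<open>quot_jacobson_radical_iso\<close>.\<close>
  have "b \<in> jacobson_radical R" if b: "b \<in> carrier R" "b \<otimes>\<^bsub>R\<^esub> a = \<zero>\<^bsub>R\<^esub>" for b
  proof -
    have ann: "b \<otimes>\<^bsub>R\<^esub> x = \<zero>\<^bsub>R\<^esub>" if "x \<in> I" for x
      using that a(1) b by (auto simp: memI m_lcomm)
    have "b \<in> I"
      by (rule annihilator_subset[OF principalideal.axioms(1)[OF assms(2)] _ assms(3-5) b(1) ann])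
        simp_all
    \<comment> \<open>As \<open>b\<close> lies in \<open>I\<close> and annihilates \<open>I\<close>,
      its square is zero.\<close>
    then show ?thesis using ann b(1) by (intro square_zero_in_jacobson_radical)
  qed
  then show ?thesis
    unfolding a(2)
    by (intro ring_hom_cring.quot_jacobson_radical_iso[OF End_ring_PIdl(2,1)[OF a(1)]])
      (auto simp: End_ring_PIdl(3)[OF a(1)] a(1))
qed

end
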